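(* Let $V$ be a real reflexive Banach space, $X$ a real Banach space, $\gamma\in\mathcal{L}(V,X)$ with $c_\gamma:=\|\gamma\|_{\mathcal{L}(V,X)}$, and $T>0$. Let $A,B\colon V\to V^*$, $J\colon X\times X\to\mathbb{R}$, $f\colon[0,T]\to V^*$ and $u_0$ satisfy: (A) $A$ is linear and bounded, symmetric ($\langle Au,v\rangle_{V^*\times V}=\langle Av,u\rangle_{V^*\times V}$ for all $u,v\in V$), and there is $m_A>0$ with $\langle Au,u\rangle_{V^*\times V}\ge m_A\|u\|_V^2$ for all $u\in V$; (B) there is $L_B>0$ with $\|Bv-Bw\|_{V^*}\le L_B\|v-w\|_V$ for all $v,w\in V$; (J) $J(w,\cdot)$ is locally Lipschitz continuous for all $w\in X$; there are $c_0,c_1,c_2\ge 0$ such that $\|\partial_2J(w,v)\|_{X^*}\le c_0+c_1\|w\|_X+c_2\|v\|_X$ for all $w,v\in X$; and there are $m_{J1},m_{J2}\ge0$ such that $$J_2^0(w_1,v_1;v_2-v_1)+J_2^0(w_2,v_2;v_1-v_2)\le m_{J1}\|v_1-v_2\|_X^2+m_{J2}\|w_1-w_2\|_X\|v_1-v_2\|_X$$ for all $w_1,w_2,v_1,v_2\in X$; (f) $f\in C([0,T];V^* )$; (u) $u_0\in V$; (s) $m_A-2m_{J1}c_\gamma^2>0$. Define $K\colon L^2(0,T;V)\to C([0,T];V)$ by $(Kv)(t)=\int_0^tv(s)\,ds+u_0$. Then the problem of finding $v\colon[0,T]\to V$ such that for all $t\in[0,T]$ $$\langle Av(t)+B(Kv)(t),w\rangle_{V^*\times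 V}+J_2^0(\gamma(Kv)(t),\gamma v(t);\gamma w)\ge\langle f(t),w\rangle_{V^*\times V}\quad\forall\,w\in V$$ has a unique solution $v\in C([0,T];V)$.
   Context: $V^*$ is the dual of $V$ and $\langle\cdot,\cdot\rangle_{V^*\times V}$ the duality pairing. For a locally Lipschitz $j\colon X\to\mathbb{R}$, the (Clarke) generalized directional derivative is $j^0(x;v)=\limsup_{y\to x,\lambda\searrow0}\frac{j(y+\lambda v)-j(y)}{\lambda}$ and the generalized subdifferential is $\partial j(x)=\{\xi\in X^*:\langle\xi,v\rangle_{X^*\times X}\le j^0(x;v)\ \forall v\in X\}$. For $J\colon X\times X\to\mathbb{R}$, $J_2^0(w,v;z)$ and $\partial_2J(w,v)$ are the generalized directional derivative at $v$ in direction $z$, and the subdifferential at $v$, of $J(w,\cdot)$. A bound $\|\partial_2J(w,v)\|_{X^*}\le C$ means $\|\xi\|_{X^*}\le C$ for every $\xi\in\partial_2J(w,v)$. *)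

theory Defs
  imports "HOL-Analysis.Analysis"
begin

text \<open>
  The dual of a real normed space \<open>'a\<close> is the library type \<open>'a \<Rightarrow>\<^sub>L real\<close> (operator norm), and the
  duality pairing of \<open>\<xi>\<close> and \<open>v\<close> is \<open>blinfun_apply \<xi> v\<close>.
\<close>

definition reflexive_space :: "'a::real_normed_vector itself \<Rightarrow> bool" where
  "reflexive_space _ \<longleftrightarrow>
     (\<forall>\<Phi> :: ('a \<Rightarrow>\<^sub>L real) \<Rightarrow>\<^sub>L real. \<exists>x::'a. \<forall>\<xi>. blinfun_apply \<Phi> \<xi> = blinfun_apply \<xi> x)"

definition locally_lipschitz :: "('a::real_normed_vector \<Rightarrow> real) \<Rightarrow> bool" where
  "locally_lipschitz j \<longleftrightarrow> (\<forall>x. \<exists>e>0. \<exists>L. L-lipschitz_on (ball x e) j)"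

text \<open>
  The \<open>limsup\<close> is over \<open>y \<rightarrow> x\<close> (with \<open>y = x\<close> allowed) and \<open>h \<searrow> 0\<close> jointly.  It is taken in the
  extended reals; it is finite whenever \<open>j\<close> is locally Lipschitz, see \<open>ereal_clarke_deriv\<close> below.
\<close>

definition clarke_deriv :: "('a::real_normed_vector \<Rightarrow> real) \<Rightarrow> 'a \<Rightarrow> 'a \<Rightarrow> real" where
  "clarke_deriv j x v =
     real_of_ereal (Limsup (nhds x \<times>\<^sub>F at_right 0)
       (\<lambda>(y, h::real). ereal ((j (y + h *\<^sub>R v) - j y) / h)))"

definition clarke_subdiff :: "('a::real_normed_vector \<Rightarrow> real) \<Rightarrow> 'a \<Rightarrow> ('a \<Rightarrow>\<^sub>L real) set" where
  "clarke_subdiff j x = {\<xi>. \<forall>v. blinfun_apply \<xi> v \<le> clarke_deriv j x v}"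

lemma ereal_clarke_deriv:
  fixes j :: "'a::real_normed_vector \<Rightarrow> real"
  assumes "locally_lipschitz j"
  shows "ereal (clarke_deriv j x v) =
     Limsup (nhds x \<times>\<^sub>F at_right 0) (\<lambda>(y, h::real). ereal ((j (y + h *\<^sub>R v) - j y) / h))"
proof -
  define F where "F = nhds x \<times>\<^sub>F at_right (0::real)"
  define q where "q = (\<lambda>(y, h::real). ereal ((j (y + h *\<^sub>R v) - j y) / h))"
  obtain e L where e: "e > 0" and L: "L-lipschitz_on (ball x e) j"
    using assms unfolding locally_lipschitz_def by blast
  have F_ne: "F \<noteq> bot"
    unfolding F_def by (simp add: prod_filter_eq_bot trivial_limit_at_right_real)
  have "((\<lambda>p. fst p + snd p *\<^sub>R v) \<longlongrightarrow> x + 0 *\<^sub>R v) F"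
  proof (intro tendsto_intros)
    show "(fst \<longlongrightarrow> x) F"
      unfolding F_def by (rule filterlim_fst)
    have "filterlim snd (at_right (0::real)) F"
      unfolding F_def by (rule filterlim_snd)
    then show "(snd \<longlongrightarrow> 0) F"
      by (rule filterlim_mono) (auto simp: at_within_def)
  qed
  then have sum_ev: "eventually (\<lambda>p. fst p + snd p *\<^sub>R v \<in> ball x e) F"
    by (rule topological_tendstoD) (use e in auto)
  have "(fst \<longlongrightarrow> x) F"
    unfolding F_def by (rule filterlim_fst)
  then have fst_ev: "eventually (\<lambda>p. fst p \<in> ball x e) F"
    by (rule topological_tendstoD) (use e in auto)
  have "filterlim snd (at_right (0::real)) F"
    unfolding F_def by (rule filterlim_snd)
  then have snd_ev: "eventually (\<lambda>p. snd p > 0) F"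
    by (rule eventually_compose_filterlim[rotated]) (simp add: eventually_at_right_less)
  have bound: "eventually (\<lambda>p. \<bar>q p\<bar> \<le> ereal (L * norm v)) F"
    using sum_ev fst_ev snd_ev
  proof eventually_elim
    case (elim p)
    obtain y h where p: "p = (y, h)" by (cases p)
    have "\<bar>j (y + h *\<^sub>R v) - j y\<bar> \<le> L * (h * norm v)"
      using lipschitz_onD[OF L, of "y + h *\<^sub>R v" y] elim by (simp add: p dist_norm)
    then show ?case
      using elim by (simp add: p q_def field_simps)
  qed
  have upper: "Limsup F q \<le> ereal (L * norm v)"
  proof (rule Limsup_bounded, use bound in eventually_elim)
    fix p show "\<bar>q p\<bar> \<le> ereal (L * norm v) \<Longrightarrow> q p \<le> ereal (L * norm v)"
      by (cases "q p") auto
  qed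
  have "- ereal (L * norm v) \<le> Liminf F q"
  proof (rule Liminf_bounded, use bound in eventually_elim)
    fix p show "\<bar>q p\<bar> \<le> ereal (L * norm v) \<Longrightarrow> - ereal (L * norm v) \<le> q p"
      by (cases "q p") auto
  qed
  then have lower: "- ereal (L * norm v) \<le> Limsup F q"
    using Liminf_le_Limsup[OF F_ne] order_trans by blast
  have "\<bar>Limsup F q\<bar> \<noteq> \<infinity>"
    using upper lower by (cases "Limsup F q") auto
  then show ?thesis
    unfolding clarke_deriv_def F_def[symmetric] q_def[symmetric] by (simp add: ereal_real')
qed

text \<open>
  Representatives of \<open>L\<^sup>2(0,T;V)\<close> in the Bochner sense.  Strong measurability is spelled out because
  the library's Bochner theory is restricted to second countable spaces, whereas \<open>V\<close> need not be
  separable.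
\<close>

definition bochner_L2 :: "real \<Rightarrow> (real \<Rightarrow> 'a::real_normed_vector) \<Rightarrow> bool" where
  "bochner_L2 T v \<longleftrightarrow>
     (\<exists>s :: nat \<Rightarrow> real \<Rightarrow> 'a. (\<forall>n. simple_function (lebesgue_on {0..T}) (s n)) \<and>
        (AE t in lebesgue_on {0..T}. (\<lambda>n. s n t) \<longlonglongrightarrow> v t)) \<and>
     integrable (lebesgue_on {0..T}) (\<lambda>t. (norm (v t))\<^sup>2)"

lemma continuous_on_imp_bochner_L2:
  fixes v :: "real \<Rightarrow> 'a::real_normed_vector"
  assumes v: "continuous_on {0..T} v"
  shows "bochner_L2 T v"
  unfolding bochner_L2_def
proof (intro conjI exI)
  define r where "r = (\<lambda>n t. real_of_int \<lfloor>real (Suc n) * t\<rfloor> / real (Suc n))"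
  have r_le: "r n t \<le> t" for n t
    using of_int_floor_le[of "real (Suc n) * t"] unfolding r_def
    by (simp add: divide_le_eq mult.commute del: of_nat_Suc)
  have r_ge: "t - 1 / real (Suc n) \<le> r n t" for n t
  proof -
    have "real (Suc n) * t - 1 \<le> real_of_int \<lfloor>real (Suc n) * t\<rfloor>"
      by linarith
    then have "(real (Suc n) * t - 1) / real (Suc n) \<le> r n t"
      unfolding r_def by (rule divide_right_mono) simp
    then show ?thesis
      by (simp add: diff_divide_distrib del: of_nat_Suc)
  qed
  have r_nonneg: "0 \<le> r n t" if "0 \<le> t" for n t
    using that unfolding r_def
    by (intro divide_nonneg_nonneg) (simp_all del: of_nat_Suc)
  show "\<forall>n. simple_function (lebesgue_on {0..T}) (v \<circ> r n)"
  proof (intro allI simple_function_compose simple_function_borel_measurable)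
    fix n
    show "r n \<in> borel_measurable (lebesgue_on {0..T})"
      unfolding r_def by (intro measurable_restrict_space1 measurable_completion) measurable
    have "r n ` {0..T} \<subseteq> (\<lambda>k. real_of_int k / real (Suc n)) ` {0..\<lfloor>real (Suc n) * T\<rfloor>}"
    proof
      fix x assume "x \<in> r n ` {0..T}"
      then obtain t where t: "0 \<le> t" "t \<le> T" and x: "x = r n t" by auto
      have "0 \<le> \<lfloor>real (Suc n) * t\<rfloor>"
        using t(1) by (subst zero_le_floor) (rule mult_nonneg_nonneg, simp_all)
      moreover have "\<lfloor>real (Suc n) * t\<rfloor> \<le> \<lfloor>real (Suc n) * T\<rfloor>"
        using t(2) by (intro floor_mono mult_left_mono) simp_all
      ultimately have "\<lfloor>real (Suc n) * t\<rfloor> \<in> {0..\<lfloor>real (Suc n) * T\<rfloor>}"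
        by (simp only: atLeastAtMost_iff)
      then show "x \<in> (\<lambda>k. real_of_int k / real (Suc n)) ` {0..\<lfloor>real (Suc n) * T\<rfloor>}"
        unfolding x r_def by (rule imageI)
    qed
    then have "finite (r n ` {0..T})"
      by (rule finite_subset) (rule finite_imageI, rule finite_atLeastAtMost_int)
    then show "finite (r n ` space (lebesgue_on {0..T}))"
      by simp
  qed
  show "AE t in lebesgue_on {0..T}. (\<lambda>n. (v \<circ> r n) t) \<longlonglongrightarrow> v t"
  proof (rule AE_I2)
    fix t assume "t \<in> space (lebesgue_on {0..T})"
    then have t: "t \<in> {0..T}" by simp
    have "(\<lambda>n. t - inverse (real (Suc n))) \<longlonglongrightarrow> t - 0"
      by (rule tendsto_diff[OF tendsto_const LIMSEQ_inverse_real_of_nat])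
    then have lim: "(\<lambda>n. t - 1 / real (Suc n)) \<longlonglongrightarrow> t"
      by (simp only: inverse_eq_divide diff_zero)
    have r_lim: "(\<lambda>n. r n t) \<longlonglongrightarrow> t"
      by (rule tendsto_sandwich[OF always_eventually always_eventually lim tendsto_const])
        (use r_ge r_le in blast)+
    have r_mem: "r n t \<in> {0..T}" for n
      using t r_le[of n t] r_nonneg[of t n] by auto
    show "(\<lambda>n. (v \<circ> r n) t) \<longlonglongrightarrow> v t"
      unfolding o_def
      by (rule continuous_on_tendsto_compose[OF v r_lim t]) (simp only: r_mem eventually_True)
  qed
  show "integrable (lebesgue_on {0..T}) (\<lambda>t. (norm (v t))\<^sup>2)"
    by (intro continuous_imp_integrable_real continuous_intros v)
qed

text \<open>
  For the same reason the integral is the Henstock--Kurzweil one, which exists and agrees with the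
  Bochner integral for every Bochner integrable function, in particular on \<open>bochner_L2\<close>.
\<close>

definition history_op :: "'a::real_normed_vector \<Rightarrow> (real \<Rightarrow> 'a) \<Rightarrow> real \<Rightarrow> 'a" where
  "history_op u0 v t = integral {0..t} v + u0"

definition hemivar_solution ::
  "real \<Rightarrow> ('v \<Rightarrow> 'v \<Rightarrow>\<^sub>L real) \<Rightarrow> ('v \<Rightarrow> 'v \<Rightarrow>\<^sub>L real) \<Rightarrow> ('x \<Rightarrow> 'x \<Rightarrow> real) \<Rightarrow>
   ('v::real_normed_vector \<Rightarrow>\<^sub>L 'x::real_normed_vector) \<Rightarrow> (real \<Rightarrow> 'v \<Rightarrow>\<^sub>L real) \<Rightarrow> 'v \<Rightarrow>
   (real \<Rightarrow> 'v) \<Rightarrow> bool" where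
  "hemivar_solution T A B J \<gamma> f u0 v \<longleftrightarrow>
     (\<forall>t\<in>{0..T}. \<forall>w.
        blinfun_apply (A (v t) + B (history_op u0 v t)) w
          + clarke_deriv (J (blinfun_apply \<gamma> (history_op u0 v t))) (blinfun_apply \<gamma> (v t))
              (blinfun_apply \<gamma> w)
        \<ge> blinfun_apply (f t) w)"

end

theory Submission
  imports Defs
begin

text \<open>
  The inequality at a single time is stationary: given the history \<open>w = (K v)(t)\<close> and the load
  \<open>\<xi> = f(t)\<close>, find \<open>v\<close> with
  \<open>\<langle>A v + B w, z\<rangle> + J\<^sub>2\<^sup>0(\<gamma> w, \<gamma> v; \<gamma> z) \<ge> \<langle>\<xi>, z\<rangle>\<close> for all \<open>z\<close>.  Because \<open>A\<close> is symmetric, this is the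
  first-order condition for a minimum of the energy
  \<open>E(v) = \<langle>A v, v\<rangle> / 2 - \<langle>\<xi> - B w, v\<rangle> + J(\<gamma> w, \<gamma> v)\<close>.
  For \<open>w\<^sub>1 = w\<^sub>2\<close> the relaxed monotonicity of \<open>J\<^sub>2\<^sup>0\<close> says that \<open>J(\<gamma> w, \<cdot>)\<close> is convex on each segment
  up to a quadratic term with factor \<open>m_J1\<close> (\<open>relaxed_monotone_imp_weakly_convex\<close>), and the
  smallness condition lets the coercivity of \<open>A\<close> absorb that term.  So \<open>E\<close> is continuous and
  strongly convex, its minimising sequences are Cauchy, and it attains its minimum
  (\<open>strongly_convex_attains_min\<close>, \<open>stationary_hemivar_exists\<close>).

  Testing the inequalities of two stationary problems with the difference of their solutions shows
  that the solution is unique and depends Lipschitz continuously on \<open>(\<xi>, w)\<close>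
  (\<open>stationary_hemivar_stable\<close>).  With the solution operator \<open>S\<close> the problem becomes the Volterra
  equation \<open>v(t) = S (f(t)) (u\<^sub>0 + \<integral>\<^sub>0\<^sup>t v)\<close>.  Existence of a continuous solution is
  Banach's fixed point theorem in a norm weighted by \<open>exp (- \<kappa> t)\<close>, and the same weighted estimate
  gives uniqueness among integrable solutions.  Finally every solution of the equation is integrable:
  beyond the last time up to which it were integrable, its integral would have the value \<open>0\<close> by
  convention, so the equation would make it continuous there too (\<open>solution_integrable\<close>).
\<close>

section \<open>Clarke derivatives and weak convexity\<close>

text \<open>
  The only way in which lower bounds on Clarke derivatives are obtained here: the upper limit over all
  base points dominates the limit along one curve \<open>y\<close> of base points.  A curve that moves with
  the step size is what makes backward differences accessible.
\<close>
lemma clarke_deriv_ge_limit: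
  fixes j :: "'a::real_normed_vector \<Rightarrow> real" and y :: "real \<Rightarrow> 'a"
  assumes j: "locally_lipschitz j"
    and y: "(y \<longlongrightarrow> x) (at_right 0)"
    and r: "(r \<longlongrightarrow> c) (at_right 0)"
    and le: "eventually (\<lambda>h. r h * h \<le> j (y h + h *\<^sub>R d) - j (y h)) (at_right 0)"
  shows "c \<le> clarke_deriv j x d"
proof -
  define q where "q = (\<lambda>(y, h::real). ereal ((j (y + h *\<^sub>R d) - j y) / h))"
  have F: "filterlim (\<lambda>h. (y h, h)) (nhds x \<times>\<^sub>F at_right 0) (at_right 0)"
    by (rule filterlim_Pair[OF y filterlim_ident])
  have "ereal c \<le> Limsup (nhds x \<times>\<^sub>F at_right 0) q"
    unfolding Limsup_def
  proof (rule INF_greatest)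
    fix P assume "P \<in> {P. eventually P (nhds x \<times>\<^sub>F at_right (0::real))}"
    then have "eventually (\<lambda>h. P (y h, h)) (at_right 0)"
      using F by (auto simp: filterlim_iff)
    then have ev: "eventually (\<lambda>h. ereal (r h) \<le> Sup (q ` Collect P)) (at_right 0)"
      using le eventually_at_right_less[of "0::real"]
    proof eventually_elim
      case (elim h)
      then have "ereal (r h) \<le> q (y h, h)"
        by (simp add: q_def field_simps)
      also have "\<dots> \<le> Sup (q ` Collect P)"
        using elim by (intro SUP_upper) auto
      finally show ?case .
    qed
    show "ereal c \<le> Sup (q ` Collect P)"
      by (rule tendsto_upperbound[OF _ ev]) (use r in auto)
  qed
  then show ?thesis
    unfolding q_def ereal_clarke_deriv[OF j, symmetric] by simp
qed

lemma locally_lipschitz_imp_continuous: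
  fixes j :: "'a::real_normed_vector \<Rightarrow> real"
  assumes "locally_lipschitz j"
  shows "continuous_on UNIV j"
proof (rule continuous_at_imp_continuous_on, rule ballI)
  fix x
  obtain e L where "e > 0" "L-lipschitz_on (ball x e) j"
    using assms unfolding locally_lipschitz_def by blast
  then show "isCont j x"
    using lipschitz_on_continuous_on continuous_on_interior
    by (metis centre_in_ball interior_open open_ball)
qed

text \<open>
  A mean value inequality for functions without a derivative: after subtraction of the secant of slope
  \<open>c\<close> the end points have equal values, so the minimum is attained somewhere other than at \<open>b\<close>, and
  to the right of it \<open>G\<close> grows with slope at least \<open>c\<close>.  The condition \<open>\<sigma> < b\<close> leaves room for a
  one-sided difference quotient.
\<close>
lemma minimum_below_secant:
  fixes G :: "real \<Rightarrow> real"
  assumes ab: "a < b" and G: "continuous_on {a..b} G" and c: "G b - G a = c * (b - a)"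
  obtains \<sigma> where "a \<le> \<sigma>" "\<sigma> < b" "\<And>\<tau>. \<tau> \<in> {a..b} \<Longrightarrow> c * (\<tau> - \<sigma>) \<le> G \<tau> - G \<sigma>"
proof -
  define H where "H = (\<lambda>\<tau>. G \<tau> - c * \<tau>)"
  have "continuous_on {a..b} H"
    unfolding H_def by (intro continuous_intros G)
  then obtain \<rho> where \<rho>: "\<rho> \<in> {a..b}" "\<And>\<tau>. \<tau> \<in> {a..b} \<Longrightarrow> H \<rho> \<le> H \<tau>"
    using continuous_attains_inf[of "{a..b}" H] ab by auto
  have "H a = H b"
    using c by (simp add: H_def algebra_simps)
  define \<sigma> where "\<sigma> = (if \<rho> = b then a else \<rho>)"
  have "H \<sigma> = H \<rho>"
    using \<open>H a = H b\<close> by (simp add: \<sigma>_def)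
  show thesis
  proof
    show "a \<le> \<sigma>" "\<sigma> < b"
      using \<rho>(1) ab by (auto simp: \<sigma>_def)
    show "c * (\<tau> - \<sigma>) \<le> G \<tau> - G \<sigma>" if "\<tau> \<in> {a..b}" for \<tau>
      using \<rho>(2)[OF that] \<open>H \<sigma> = H \<rho>\<close> unfolding H_def by (simp add: algebra_simps)
  qed
qed

text \<open>
  With \<open>d = y - x\<close>, this is convexity of \<open>G(\<tau>) = j(x + \<tau> d) + m/2 \<parallel>d\<parallel>\<^sup>2 \<tau>\<^sup>2\<close> on \<open>[0,1]\<close>, i.e. that
  the slope \<open>c1\<close> of the secant over \<open>[0,s]\<close> is at most the slope \<open>c2\<close> of the secant over \<open>[s,1]\<close>.
  There are points \<open>\<sigma> < s \<le> \<rho>\<close> where \<open>G\<close> minus the first secant has a minimum and \<open>G\<close> minus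
  the second one a maximum, on the right.  They bound the Clarke derivatives of \<open>j\<close> at \<open>\<sigma>\<close> towards
  \<open>\<rho>\<close> and at \<open>\<rho>\<close> towards \<open>\<sigma>\<close> from below; the hypothesis bounds their sum from above, and the
  quadratic terms cancel exactly.
\<close>
lemma relaxed_monotone_imp_weakly_convex:
  fixes j :: "'a::real_normed_vector \<Rightarrow> real"
  assumes j: "locally_lipschitz j"
    and relaxed: "\<And>x y. clarke_deriv j x (y - x) + clarke_deriv j y (x - y) \<le> m * (norm (x - y))\<^sup>2"
    and s: "0 \<le> s" "s \<le> 1"
  shows "j ((1 - s) *\<^sub>R x + s *\<^sub>R y)
    \<le> (1 - s) * j x + s * j y + m / 2 * (s * (1 - s)) * (norm (x - y))\<^sup>2"
proof (cases "s = 0 \<or> s = 1")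
  case True
  then show ?thesis by auto
next
  case False
  then have s01: "0 < s" "s < 1" using s by auto
  define d where "d = y - x"
  define M where "M = m * (norm d)\<^sup>2"
  define p where "p = (\<lambda>\<tau>. x + \<tau> *\<^sub>R d)"
  define G where "G = (\<lambda>\<tau>. j (p \<tau>) + M / 2 * \<tau>\<^sup>2)"
  have G_cont: "continuous_on S G" for S
    unfolding G_def p_def
    by (intro continuous_intros continuous_on_compose2[OF locally_lipschitz_imp_continuous[OF j]]) auto
  define c1 where "c1 = (G s - G 0) / s"
  define c2 where "c2 = (G 1 - G s) / (1 - s)"
  obtain \<sigma> where \<sigma>: "0 \<le> \<sigma>" "\<sigma> < s" "\<And>\<tau>. \<tau> \<in> {0..s} \<Longrightarrow> c1 * (\<tau> - \<sigma>) \<le> G \<tau> - G \<sigma>"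
    using minimum_below_secant[OF s01(1) G_cont, of c1] s01 unfolding c1_def by auto
  have "continuous_on {s..1} (\<lambda>\<tau>. - G \<tau>)"
    by (intro continuous_intros G_cont)
  then obtain \<rho> where \<rho>: "s \<le> \<rho>" "\<rho> < 1" "\<And>\<tau>. \<tau> \<in> {s..1} \<Longrightarrow> - c2 * (\<tau> - \<rho>) \<le> - G \<tau> + G \<rho>"
    using minimum_below_secant[OF s01(2), of "\<lambda>\<tau>. - G \<tau>" "- c2"] s01 unfolding c2_def
    by (auto simp: field_simps)
  define D where "D = \<rho> - \<sigma>"
  have D: "D > 0" using \<sigma> \<rho> by (simp add: D_def)
  have p_diff: "p \<rho> - p \<sigma> = D *\<^sub>R d"
    by (simp add: p_def D_def scaleR_diff_left)
  have small: "eventually (\<lambda>h::real. h < e) (at_right 0)" if "e > 0" for e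
    using that eventually_at_right_field by blast
  have pos: "eventually (\<lambda>h::real. 0 < h) (at_right 0)"
    by (rule eventually_at_right_less)
  have 1: "D * (c1 - M * \<sigma>) \<le> clarke_deriv j (p \<sigma>) (p \<rho> - p \<sigma>)"
  proof (rule clarke_deriv_ge_limit[OF j tendsto_const])
    show "((\<lambda>h. D * (c1 - M * \<sigma>) - M / 2 * D\<^sup>2 * h) \<longlongrightarrow> D * (c1 - M * \<sigma>)) (at_right 0)"
      by (rule tendsto_eq_intros refl | simp)+
    have "(s - \<sigma>) / D > 0" using \<sigma> D by simp
    from small[OF this] pos
    show "\<forall>\<^sub>F h in at_right 0. (D * (c1 - M * \<sigma>) - M / 2 * D\<^sup>2 * h) * h
        \<le> j (p \<sigma> + h *\<^sub>R (p \<rho> - p \<sigma>)) - j (p \<sigma>)"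
    proof eventually_elim
      case (elim h)
      define \<tau> where "\<tau> = \<sigma> + h * D"
      have "\<tau> \<in> {0..s}"
        using elim D \<sigma> by (auto simp: \<tau>_def field_simps)
      then have "c1 * (\<tau> - \<sigma>) \<le> G \<tau> - G \<sigma>" by (rule \<sigma>)
      moreover have "p \<sigma> + h *\<^sub>R (p \<rho> - p \<sigma>) = p \<tau>"
        unfolding p_diff by (simp add: p_def \<tau>_def scaleR_add_left)
      ultimately show ?case
        by (simp add: G_def \<tau>_def power2_eq_square field_simps)
    qed
  qed
  \<comment> \<open>The direction at \<open>\<rho>\<close> points backwards, whereas the maximum is known on the right of \<open>\<rho>\<close> only;
      hence the difference quotients are based at \<open>\<rho> + h D\<close> and end at \<open>\<rho>\<close>.\<close>
  have 2: "D * (M * \<rho> - c2) \<le> clarke_deriv j (p \<rho>) (p \<sigma> - p \<rho>)"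
  proof (rule clarke_deriv_ge_limit[OF j])
    have p_cont: "isCont p \<tau>" for \<tau>
      unfolding p_def by (intro continuous_intros)
    have "((\<lambda>h. \<rho> + h * D) \<longlongrightarrow> \<rho>) (at_right 0)"
      by (rule tendsto_eq_intros refl | simp)+
    then show "((\<lambda>h. p (\<rho> + h * D)) \<longlongrightarrow> p \<rho>) (at_right 0)"
      by (rule isCont_tendsto_compose[OF p_cont])
    show "((\<lambda>h. D * (M * \<rho> - c2) + M / 2 * D\<^sup>2 * h) \<longlongrightarrow> D * (M * \<rho> - c2)) (at_right 0)"
      by (rule tendsto_eq_intros refl | simp)+
    have "(1 - \<rho>) / D > 0" using \<rho> D by simp
    from small[OF this] pos
    show "\<forall>\<^sub>F h in at_right 0. (D * (M * \<rho> - c2) + M / 2 * D\<^sup>2 * h) * h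
        \<le> j (p (\<rho> + h * D) + h *\<^sub>R (p \<sigma> - p \<rho>)) - j (p (\<rho> + h * D))"
    proof eventually_elim
      case (elim h)
      define \<tau> where "\<tau> = \<rho> + h * D"
      have "\<tau> \<le> 1" using elim D by (simp add: \<tau>_def field_simps)
      moreover have "\<rho> \<le> \<tau>" using elim D by (simp add: \<tau>_def)
      ultimately have "- c2 * (\<tau> - \<rho>) \<le> - G \<tau> + G \<rho>"
        using \<rho>(1) by (intro \<rho>(3)) simp
      moreover have "p (\<rho> + h * D) + h *\<^sub>R (p \<sigma> - p \<rho>) = p \<rho>"
        using p_diff by (simp add: p_def algebra_simps D_def)
      ultimately show ?case
        by (simp add: G_def \<tau>_def power2_eq_square field_simps)
    qed
  qed
  have "D * (c1 - M * \<sigma>) + D * (M * \<rho> - c2) \<le> m * (norm (p \<sigma> - p \<rho>))\<^sup>2"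
    using 1 2 relaxed[of "p \<sigma>" "p \<rho>"] by linarith
  also have "\<dots> = D * (M * D)"
    using p_diff D by (simp add: norm_minus_commute[of "p \<sigma>"] M_def power2_eq_square)
  finally have "D * (c1 - c2) \<le> 0"
    by (simp add: D_def algebra_simps)
  then have "c1 \<le> c2"
    using D by (simp add: mult_le_0_iff)
  then have "(G s - G 0) * (1 - s) \<le> (G 1 - G s) * s"
    using s01 unfolding c1_def c2_def by (simp add: divide_simps mult.commute split: if_splits)
  then have "G s \<le> (1 - s) * G 0 + s * G 1"
    by (simp add: algebra_simps)
  moreover have "p s = (1 - s) *\<^sub>R x + s *\<^sub>R y" "p 0 = x" "p 1 = y"
    by (simp_all add: p_def d_def algebra_simps)
  ultimately show ?thesis
    unfolding G_def M_def d_def norm_minus_commute[of y x]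
    by (simp add: power2_eq_square[of s] field_simps)
qed

section \<open>Minimisation of strongly convex functions\<close>

text \<open>
  Strong convexity replaces compactness: two points with almost minimal values are close, since
  otherwise their midpoint would have a value below the infimum.  Hence minimising sequences are Cauchy.
\<close>
lemma strongly_convex_attains_min:
  fixes E :: "'a::banach \<Rightarrow> real"
  assumes cont: "continuous_on UNIV E" and \<alpha>: "\<alpha> > 0"
    and convex: "\<And>x y s. 0 \<le> s \<Longrightarrow> s \<le> 1 \<Longrightarrow>
      E ((1 - s) *\<^sub>R x + s *\<^sub>R y) \<le> (1 - s) * E x + s * E y - \<alpha> * (s * (1 - s)) * (norm (x - y))\<^sup>2"
  obtains v where "\<And>u. E v \<le> E u"
proof -
  have isCont: "isCont E x" for x
    using cont by (simp add: continuous_on_eq_continuous_at)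
  obtain r where r: "r > 0" "\<And>x. norm x < r \<Longrightarrow> E 0 - 1 < E x"
  proof -
    have "eventually (\<lambda>x. E 0 - 1 < E x) (nhds 0)"
      using isCont[of 0] by (intro order_tendstoD(1)[of E "E 0"]) (auto simp: isCont_def tendsto_at_iff_tendsto_nhds)
    then show ?thesis
      using that unfolding eventually_nhds_metric by (auto simp: dist_norm)
  qed
  \<comment> \<open>Continuity bounds \<open>E\<close> below near \<open>0\<close>.  For a distant \<open>x\<close>, convexity on the segment from \<open>0\<close> to
      \<open>x\<close> carries that bound outwards with a loss linear in \<open>norm x\<close>, which the quadratic gain outweighs.\<close>
  have bounded: "E 0 - 1 - 2 / (\<alpha> * r\<^sup>2) \<le> E x" for x
  proof (cases "norm x < r")
    case True
    moreover have "0 \<le> 2 / (\<alpha> * r\<^sup>2)" using \<alpha> by simp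
    ultimately show ?thesis using r(2)[OF True] by linarith
  next
    case False
    define s where "s = r / (2 * norm x)"
    have x: "norm x > 0" using False r(1) by linarith
    then have x0: "x \<noteq> 0" by simp
    have s: "0 < s" "s \<le> 1 / 2" using False r(1) x x0 by (auto simp: s_def field_simps)
    have "norm (s *\<^sub>R x) < r" using r(1) x0 by (simp add: s_def)
    then have "E 0 - 1 < E (s *\<^sub>R x)" by (rule r(2))
    also have "\<dots> \<le> (1 - s) * E 0 + s * E x - \<alpha> * (s * (1 - s)) * (norm x)\<^sup>2"
      using convex[of s 0 x] s by simp
    finally have "s * (E 0 - E x + \<alpha> * (1 - s) * (norm x)\<^sup>2) < 1"
      by (simp add: algebra_simps)
    then have "E 0 - E x + \<alpha> * (1 - s) * (norm x)\<^sup>2 < 1 / s"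
      using s by (simp add: field_simps)
    moreover have "\<alpha> / 2 * (norm x)\<^sup>2 \<le> \<alpha> * (1 - s) * (norm x)\<^sup>2"
      using s \<alpha> by (intro mult_right_mono) auto
    moreover have "1 / s = 2 * norm x / r"
      by (simp add: s_def)
    moreover have "2 * norm x / r \<le> \<alpha> / 2 * (norm x)\<^sup>2 + 2 / (\<alpha> * r\<^sup>2)"
    proof -
      \<comment> \<open>Young's inequality, in the form of a completed square.\<close>
      have "0 \<le> (\<alpha> * r * norm x - 2)\<^sup>2" by simp
      then have "4 * \<alpha> * r * norm x \<le> (\<alpha> * r * norm x)\<^sup>2 + 4"
        by (simp add: power2_eq_square algebra_simps)
      then have "4 * \<alpha> * r * norm x / (2 * \<alpha> * r\<^sup>2) \<le> ((\<alpha> * r * norm x)\<^sup>2 + 4) / (2 * \<alpha> * r\<^sup>2)"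
        using \<alpha> r(1) by (intro divide_right_mono) auto
      also have "\<dots> = \<alpha> / 2 * (norm x)\<^sup>2 + 2 / (\<alpha> * r\<^sup>2)"
        using \<alpha> r(1) by (simp add: field_simps power2_eq_square)
      finally show ?thesis
        using \<alpha> r(1) by (simp add: field_simps power2_eq_square)
    qed
    ultimately show ?thesis by linarith
  qed
  define \<mu> where "\<mu> = (INF x. E x)"
  have bdd: "bdd_below (range E)"
    using bounded by (rule bdd_belowI2)
  then have \<mu>_le: "\<mu> \<le> E x" for x
    unfolding \<mu>_def by (rule cINF_lower) simp
  have "\<exists>x. E x < \<mu> + inverse (real (Suc n))" for n
    unfolding \<mu>_def using cINF_less_iff[OF UNIV_not_empty bdd, of "(INF x. E x) + inverse (real (Suc n))"]
    by (simp del: of_nat_Suc)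
  then obtain u where u: "\<And>n. E (u n) < \<mu> + inverse (real (Suc n))"
    by metis
  have E_lim: "(\<lambda>n. E (u n)) \<longlonglongrightarrow> \<mu>"
  proof (rule tendsto_sandwich[OF _ _ tendsto_const])
    show "(\<lambda>n. \<mu> + inverse (real (Suc n))) \<longlonglongrightarrow> \<mu>"
      using tendsto_add[OF tendsto_const LIMSEQ_inverse_real_of_nat, of \<mu>] by simp
  qed (use \<mu>_le u less_imp_le in \<open>auto intro!: always_eventually\<close>)
  have close: "\<alpha> / 2 * (norm (x - y))\<^sup>2 \<le> (E x - \<mu>) + (E y - \<mu>)" for x y
    using convex[of "1/2" x y] \<mu>_le[of "(1 - 1/2) *\<^sub>R x + (1/2) *\<^sub>R y"] by simp
  have "Cauchy u"
  proof (rule metric_CauchyI)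
    fix e :: real assume e: "e > 0"
    define \<delta> where "\<delta> = \<alpha> / 4 * e\<^sup>2"
    have "\<delta> > 0" using e \<alpha> by (simp add: \<delta>_def)
    then have "eventually (\<lambda>n. E (u n) < \<mu> + \<delta>) sequentially"
      using E_lim by (intro order_tendstoD(2)) auto
    then obtain N where N: "\<And>n. n \<ge> N \<Longrightarrow> E (u n) < \<mu> + \<delta>"
      unfolding eventually_sequentially by blast
    have "dist (u k) (u n) < e" if "k \<ge> N" "n \<ge> N" for k n
    proof -
      have "\<alpha> / 2 * (norm (u k - u n))\<^sup>2 < \<alpha> / 2 * e\<^sup>2"
        using close[of "u k" "u n"] N[OF that(1)] N[OF that(2)] by (simp add: \<delta>_def)
      then have "(norm (u k - u n))\<^sup>2 < e\<^sup>2"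
        using \<alpha> by simp
      then show ?thesis
        using e by (simp add: dist_norm power2_less_imp_less)
    qed
    then show "\<exists>N. \<forall>k\<ge>N. \<forall>n\<ge>N. dist (u k) (u n) < e" by blast
  qed
  then obtain v where "u \<longlonglongrightarrow> v"
    using Cauchy_convergent convergent_def by blast
  then have "(\<lambda>n. E (u n)) \<longlonglongrightarrow> E v"
    by (rule isCont_tendsto_compose[OF isCont])
  then have "E v = \<mu>"
    using E_lim LIMSEQ_unique by blast
  then show thesis
    using that \<mu>_le by metis
qed

section \<open>The stationary inequality\<close>

text \<open>
  The solution is the minimiser of \<open>v \<mapsto> \<langle>A v, v\<rangle> / 2 - \<langle>g, v\<rangle> + j (\<gamma> v)\<close>.  At a minimiser all
  difference quotients of the energy are nonnegative, and Clarke's derivative dominates those of \<open>j\<close>.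
\<close>
lemma stationary_hemivar_exists:
  fixes A :: "'v::banach \<Rightarrow> 'v \<Rightarrow>\<^sub>L real" and \<gamma> :: "'v \<Rightarrow>\<^sub>L 'x::real_normed_vector"
  assumes A: "bounded_linear A" "\<And>u v. A u v = A v u" "\<And>u. a * (norm u)\<^sup>2 \<le> A u u"
    and j: "locally_lipschitz j"
    and relaxed: "\<And>x y. clarke_deriv j x (y - x) + clarke_deriv j y (x - y) \<le> m * (norm (x - y))\<^sup>2"
    and m: "0 \<le> m" "m * (norm \<gamma>)\<^sup>2 < a"
  shows "\<exists>v. \<forall>z. blinfun_apply g z \<le> A v z + clarke_deriv j (\<gamma> v) (\<gamma> z)"
proof -
  interpret A: bounded_linear A by (rule A(1))
  note A_simps = A.add A.diff A.scaleR blinfun.bilinear_simps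
  define E where "E = (\<lambda>v. A v v / 2 - g v + j (\<gamma> v))"
  define \<alpha> where "\<alpha> = (a - m * (norm \<gamma>)\<^sup>2) / 2"
  have E_cont: "continuous_on UNIV E"
    unfolding E_def
    by (intro continuous_intros A.continuous_on
        continuous_on_compose2[OF locally_lipschitz_imp_continuous[OF j]]) auto
  have E_convex: "E ((1 - s) *\<^sub>R x + s *\<^sub>R y)
      \<le> (1 - s) * E x + s * E y - \<alpha> * (s * (1 - s)) * (norm (x - y))\<^sup>2"
    if s: "0 \<le> s" "s \<le> 1" for x y s
  proof -
    define w where "w = (1 - s) *\<^sub>R x + s *\<^sub>R y"
    have quadratic: "A w w = (1 - s) * A x x + s * A y y - s * (1 - s) * A (x - y) (x - y)"
      unfolding w_def by (simp add: A_simps A(2)[of y x] algebra_simps)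
    have "a * (norm (x - y))\<^sup>2 \<le> A (x - y) (x - y)" by (rule A(3))
    moreover have "m * (norm (\<gamma> x - \<gamma> y))\<^sup>2 \<le> m * (norm \<gamma>)\<^sup>2 * (norm (x - y))\<^sup>2"
      using m(1) norm_blinfun[of \<gamma> "x - y"]
      by (simp add: blinfun.diff_right power_mono mult_left_mono mult.assoc flip: power_mult_distrib)
    moreover have "2 * \<alpha> * (norm (x - y))\<^sup>2
        = a * (norm (x - y))\<^sup>2 - m * (norm \<gamma>)\<^sup>2 * (norm (x - y))\<^sup>2"
      by (simp add: \<alpha>_def field_simps)
    ultimately have "2 * \<alpha> * (norm (x - y))\<^sup>2
        \<le> A (x - y) (x - y) - m * (norm (\<gamma> x - \<gamma> y))\<^sup>2"
      by linarith
    then have "s * (1 - s) * (2 * \<alpha> * (norm (x - y))\<^sup>2)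
        \<le> s * (1 - s) * (A (x - y) (x - y) - m * (norm (\<gamma> x - \<gamma> y))\<^sup>2)"
      using s by (intro mult_left_mono mult_nonneg_nonneg) auto
    moreover have "j (\<gamma> w) \<le> (1 - s) * j (\<gamma> x) + s * j (\<gamma> y)
        + m / 2 * (s * (1 - s)) * (norm (\<gamma> x - \<gamma> y))\<^sup>2"
      using relaxed_monotone_imp_weakly_convex[OF j relaxed s, of "\<gamma> x" "\<gamma> y"]
      by (simp add: w_def blinfun.bilinear_simps)
    moreover have "g w = (1 - s) * g x + s * g y"
      by (simp add: w_def blinfun.bilinear_simps)
    ultimately show ?thesis
      unfolding w_def[symmetric] E_def quadratic by (simp add: field_simps)
  qed
  have "\<alpha> > 0" using m by (simp add: \<alpha>_def)
  obtain v where v: "\<And>u. E v \<le> E u"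
    using strongly_convex_attains_min[OF E_cont \<open>\<alpha> > 0\<close> E_convex] by blast
  have "g z \<le> A v z + clarke_deriv j (\<gamma> v) (\<gamma> z)" for z
  proof -
    have "g z - A v z \<le> clarke_deriv j (\<gamma> v) (\<gamma> z)"
    proof (rule clarke_deriv_ge_limit[OF j tendsto_const])
      show "((\<lambda>h. g z - A v z - A z z / 2 * h) \<longlongrightarrow> g z - A v z) (at_right 0)"
        by (rule tendsto_eq_intros refl | simp)+
      show "\<forall>\<^sub>F h in at_right 0. (g z - A v z - A z z / 2 * h) * h \<le> j (\<gamma> v + h *\<^sub>R \<gamma> z) - j (\<gamma> v)"
      proof (rule always_eventually, rule allI)
        fix h
        show "(g z - A v z - A z z / 2 * h) * h \<le> j (\<gamma> v + h *\<^sub>R \<gamma> z) - j (\<gamma> v)"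
          using v[of "v + h *\<^sub>R z"]
          by (simp add: E_def A_simps A(2)[of z v] field_simps)
      qed
    qed
    then show ?thesis by simp
  qed
  then show ?thesis by blast
qed

text \<open>
  The first inequality is tested with \<open>v2 - v1\<close>, the second one with \<open>v1 - v2\<close>; in the sum the two
  Clarke derivatives are controlled by the relaxed monotonicity.  The term with \<open>k\<close> measures how far
  \<open>j1\<close> and \<open>j2\<close> are apart.
\<close>
lemma stationary_hemivar_stable:
  fixes A :: "'v::real_normed_vector \<Rightarrow> 'v \<Rightarrow>\<^sub>L real" and \<gamma> :: "'v \<Rightarrow>\<^sub>L 'x::real_normed_vector"
  assumes A: "bounded_linear A" "\<And>u. a * (norm u)\<^sup>2 \<le> A u u"
    and relaxed: "\<And>x y. clarke_deriv j1 x (y - x) + clarke_deriv j2 y (x - y)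
      \<le> m * (norm (x - y))\<^sup>2 + k * norm (x - y)"
    and mk: "0 \<le> m" "0 \<le> k"
    and v1: "\<And>z. blinfun_apply g1 z \<le> A v1 z + clarke_deriv j1 (\<gamma> v1) (\<gamma> z)"
    and v2: "\<And>z. blinfun_apply g2 z \<le> A v2 z + clarke_deriv j2 (\<gamma> v2) (\<gamma> z)"
  shows "(a - m * (norm \<gamma>)\<^sup>2) * norm (v1 - v2) \<le> norm (g1 - g2) + k * norm \<gamma>"
proof (cases "v1 = v2")
  case True
  then show ?thesis using mk by simp
next
  case False
  interpret A: bounded_linear A by (rule A(1))
  define d where "d = v1 - v2"
  have "a * (norm d)\<^sup>2 \<le> A d d" by (rule A(2))
  also have "\<dots> \<le> (g1 - g2) d + (m * (norm (\<gamma> d))\<^sup>2 + k * norm (\<gamma> d))"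
    using v1[of "v2 - v1"] v2[of "v1 - v2"] relaxed[of "\<gamma> v1" "\<gamma> v2"]
    by (simp add: d_def A.diff blinfun.bilinear_simps)
  also have "\<dots> \<le> norm (g1 - g2) * norm d + (m * (norm \<gamma> * norm d)\<^sup>2 + k * (norm \<gamma> * norm d))"
    using mk norm_blinfun[of \<gamma> d] norm_blinfun[of "g1 - g2" d]
    by (intro add_mono mult_left_mono power_mono) auto
  finally have "((a - m * (norm \<gamma>)\<^sup>2) * norm d) * norm d \<le> (norm (g1 - g2) + k * norm \<gamma>) * norm d"
    by (simp add: power2_eq_square algebra_simps)
  then show ?thesis
    using False by (simp add: d_def)
qed

section \<open>A Volterra equation\<close>

lemma continuous_on_lipschitz_family:
  fixes F :: "real \<Rightarrow> 'a::real_normed_vector \<Rightarrow> 'b::real_normed_vector"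
  assumes lip: "\<And>t a b. t \<in> S \<Longrightarrow> norm (F t a - F t b) \<le> L * norm (a - b)"
    and F: "\<And>a. continuous_on S (\<lambda>t. F t a)" and w: "continuous_on S w"
  shows "continuous_on S (\<lambda>t. F t (w t))"
  unfolding continuous_on_def
proof
  fix t assume t: "t \<in> S"
  have "((\<lambda>s. F s (w s) - F s (w t)) \<longlongrightarrow> 0) (at t within S)"
  proof (rule Lim_null_comparison)
    show "\<forall>\<^sub>F s in at t within S. norm (F s (w s) - F s (w t)) \<le> L * norm (w s - w t)"
      using lip by (auto simp: eventually_at_filter)
    have "((\<lambda>s. L * norm (w s - w t)) \<longlongrightarrow> L * norm (w t - w t)) (at t within S)"
      using w t by (intro tendsto_intros) (auto simp: continuous_on_def)
    then show "((\<lambda>s. L * norm (w s - w t)) \<longlongrightarrow> 0) (at t within S)" by simp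
  qed
  moreover have "((\<lambda>s. F s (w t)) \<longlongrightarrow> F t (w t)) (at t within S)"
    using F[of "w t"] t by (auto simp: continuous_on_def)
  ultimately show "((\<lambda>s. F s (w s)) \<longlongrightarrow> F t (w t)) (at t within S)"
    using tendsto_add by fastforce
qed

text \<open>
  Integration gains a factor \<open>1 / \<kappa>\<close> in the norm \<open>sup \<parallel>v s\<parallel> exp (- \<kappa> s)\<close>.  With \<open>\<kappa> = 2 * L\<close> the
  \<open>L\<close>-Lipschitz right-hand side of a Volterra equation thus becomes a contraction on an interval of
  any length.
\<close>
lemma norm_integral_le_exp:
  fixes v :: "real \<Rightarrow> 'a::banach"
  assumes "0 \<le> t" "0 < \<kappa>" "0 \<le> M" and v: "v integrable_on {0..t}"
    and bound: "\<And>s. s \<in> {0..t} \<Longrightarrow> norm (v s) \<le> M * exp (\<kappa> * s)"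
  shows "norm (integral {0..t} v) \<le> M / \<kappa> * exp (\<kappa> * t)"
proof -
  have *: "((\<lambda>s. M * exp (\<kappa> * s)) has_integral M / \<kappa> * exp (\<kappa> * t) - M / \<kappa> * exp (\<kappa> * 0)) {0..t}"
    using assms(1,2)
    by (intro fundamental_theorem_of_calculus)
      (auto intro!: derivative_eq_intros simp flip: has_real_derivative_iff_has_vector_derivative)
  have "norm (integral {0..t} v) \<le> integral {0..t} (\<lambda>s. M * exp (\<kappa> * s))"
    using integral_norm_bound_integral[OF v has_integral_integrable[OF *] bound] .
  also have "\<dots> = M / \<kappa> * exp (\<kappa> * t) - M / \<kappa>"
    using integral_unique[OF *] by simp
  also have "\<dots> \<le> M / \<kappa> * exp (\<kappa> * t)"
    using assms(2,3) by simp
  finally show ?thesis .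
qed

lemma continuous_on_history_op:
  fixes v :: "real \<Rightarrow> 'a::banach"
  assumes "v integrable_on {0..T}"
  shows "continuous_on {0..T} (history_op u0 v)"
  unfolding history_op_def by (intro continuous_intros indefinite_integral_continuous_1 assms)

text \<open>The equation \<open>v t = F t (u0 + \<integral>\<^sub>0\<^sup>t v)\<close>.\<close>
locale volterra_equation =
  fixes F :: "real \<Rightarrow> 'v::banach \<Rightarrow> 'v" and L T :: real and u0 :: 'v
  assumes T: "0 \<le> T" and L: "L > 0"
    and lip: "\<And>t a b. t \<in> {0..T} \<Longrightarrow> norm (F t a - F t b) \<le> L * norm (a - b)"
    and F_cont: "\<And>a. continuous_on {0..T} (\<lambda>t. F t a)"
begin

text \<open>
  The unknown is \<open>u t = exp (- \<kappa> * t) *\<^sub>R v t\<close>, for which the weighted norm is the supremum norm of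
  bounded continuous functions.  These live on the whole line, so the right-hand side \<open>R u\<close> is extended
  by its boundary values outside \<open>[0,T]\<close>.
\<close>
lemma ex_continuous_solution:
  obtains v where "continuous_on {0..T} v" "\<And>t. t \<in> {0..T} \<Longrightarrow> v t = F t (history_op u0 v t)"
proof -
  define \<kappa> where "\<kappa> = 2 * L"
  have \<kappa>: "\<kappa> > 0" using L by (simp add: \<kappa>_def)
  define lift where "lift = (\<lambda>u::real \<Rightarrow>\<^sub>C 'v. \<lambda>s. exp (\<kappa> * s) *\<^sub>R u s)"
  define R where "R = (\<lambda>u t. exp (- \<kappa> * t) *\<^sub>R F t (history_op u0 (lift u) t))"
  have lift_cont: "continuous_on S (lift u)" for S u
    unfolding lift_def by (intro continuous_intros) auto
  have lift_int: "lift u integrable_on {0..t}" for u t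
    by (intro integrable_continuous_interval lift_cont)
  have R_cont: "continuous_on (cbox 0 T) (R u)" for u
    unfolding R_def cbox_interval
    by (intro continuous_intros continuous_on_lipschitz_family[OF lip F_cont]
        continuous_on_history_op lift_int)
  have "\<exists>g::real \<Rightarrow>\<^sub>C 'v. \<forall>t. g t = R u (clamp 0 T t)" for u
    using continuous_on_cbox_bcontfunE[OF R_cont] by metis
  then obtain \<Phi> :: "(real \<Rightarrow>\<^sub>C 'v) \<Rightarrow> real \<Rightarrow>\<^sub>C 'v" where \<Phi>: "\<And>u t. \<Phi> u t = R u (clamp 0 T t)"
    by metis
  have R_lip: "norm (R x t - R y t) \<le> 1 / 2 * dist x y" if t: "t \<in> {0..T}" for x y t
  proof -
    have "norm (history_op u0 (lift x) t - history_op u0 (lift y) t)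
        = norm (integral {0..t} (\<lambda>s. lift x s - lift y s))"
      by (simp add: history_op_def integral_diff[OF lift_int lift_int])
    also have "\<dots> \<le> dist x y / \<kappa> * exp (\<kappa> * t)"
    proof (rule norm_integral_le_exp)
      show "(\<lambda>s. lift x s - lift y s) integrable_on {0..t}"
        by (intro integrable_diff lift_int)
      show "norm (lift x s - lift y s) \<le> dist x y * exp (\<kappa> * s)" for s
        using dist_bounded[of x s y]
        by (simp add: lift_def dist_norm mult.commute flip: scaleR_diff_right)
    qed (use t \<kappa> in auto)
    finally have "norm (F t (history_op u0 (lift x) t) - F t (history_op u0 (lift y) t))
        \<le> L * (dist x y / \<kappa> * exp (\<kappa> * t))"
      using lip[OF t, of "history_op u0 (lift x) t" "history_op u0 (lift y) t"] L
      by (meson mult_left_mono less_imp_le order_trans)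
    also have "\<dots> = 1 / 2 * dist x y * exp (\<kappa> * t)"
      using L by (simp add: \<kappa>_def)
    finally have "exp (- \<kappa> * t) * norm (F t (history_op u0 (lift x) t) - F t (history_op u0 (lift y) t))
        \<le> exp (- \<kappa> * t) * (1 / 2 * dist x y * exp (\<kappa> * t))"
      by (intro mult_left_mono) auto
    also have "\<dots> = 1 / 2 * dist x y"
      by (simp add: exp_minus)
    finally show ?thesis
      by (simp add: R_def flip: scaleR_diff_right)
  qed
  have "dist (\<Phi> x) (\<Phi> y) \<le> 1 / 2 * dist x y" for x y
  proof -
    have "clamp 0 T t \<in> cbox 0 T" for t
      by (rule clamp_in_interval) (use T in simp)
    then have "clamp 0 T t \<in> {0..T}" for t
      by (simp only: cbox_interval)
    note R_lip[where x = x and y = y, OF this]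
    then show ?thesis
      by (intro dist_bound) (simp only: \<Phi> dist_norm[of "R x _"])
  qed
  then obtain u where u: "\<Phi> u = u"
    using banach_fix_type[of "1/2" \<Phi>] by auto
  show thesis
  proof
    show "continuous_on {0..T} (lift u)" by (rule lift_cont)
    show "lift u t = F t (history_op u0 (lift u) t)" if "t \<in> {0..T}" for t
    proof -
      have "clamp 0 T t = t"
        by (rule clamp_cancel_cbox) (use that in \<open>simp only: cbox_interval\<close>)
      then have "u t = R u t"
        using \<Phi>[of u t] by (simp only: u)
      then have "lift u t = exp (\<kappa> * t) *\<^sub>R R u t"
        by (simp only: lift_def)
      then show ?thesis
        by (simp add: R_def exp_minus)
    qed
  qed
qed

text \<open>
  At a maximum \<open>r\<close> of the weighted difference \<open>q\<close>, the contraction estimate reads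
  \<open>q r \<le> q r / 2\<close>.  An initial interval \<open>[0,a]\<close> is allowed because the integrability of a
  solution on all of \<open>[0,T]\<close> is derived from this uniqueness.
\<close>
lemma integrable_solutions_eq:
  assumes a: "a \<le> T"
    and int: "v integrable_on {0..a}" "w integrable_on {0..a}"
    and v: "\<And>t. t \<in> {0..a} \<Longrightarrow> v t = F t (history_op u0 v t)"
    and w: "\<And>t. t \<in> {0..a} \<Longrightarrow> w t = F t (history_op u0 w t)"
    and t: "t \<in> {0..a}"
  shows "v t = w t"
proof -
  define \<kappa> where "\<kappa> = 2 * L"
  have \<kappa>: "\<kappa> > 0" using L by (simp add: \<kappa>_def)
  have sub: "{0..a} \<subseteq> {0..T}" using a by auto
  have solution_cont: "continuous_on {0..a} x"
    if "x integrable_on {0..a}" "\<And>t. t \<in> {0..a} \<Longrightarrow> x t = F t (history_op u0 x t)" for x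
  proof -
    have "continuous_on {0..a} (\<lambda>t. F t (history_op u0 x t))"
      by (rule continuous_on_lipschitz_family[OF lip continuous_on_subset[OF F_cont sub]
            continuous_on_history_op[OF that(1)]]) (use sub in auto)
    then show ?thesis
      by (subst continuous_on_cong[OF refl that(2)])
  qed
  define q where "q = (\<lambda>t. exp (- \<kappa> * t) * norm (v t - w t))"
  have "continuous_on {0..a} q"
    unfolding q_def using solution_cont[OF int(1) v] solution_cont[OF int(2) w]
    by (intro continuous_intros)
  then obtain r where r: "r \<in> {0..a}" "\<And>s. s \<in> {0..a} \<Longrightarrow> q s \<le> q r"
    using continuous_attains_sup[of "{0..a}" q] t by auto
  have diff: "norm (v s - w s) = q s * exp (\<kappa> * s)" for s
    by (simp add: q_def exp_minus)
  have "v integrable_on {0..r}" "w integrable_on {0..r}"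
    using int r(1) by (auto intro: integrable_subinterval_real)
  note int_r = this
  have "norm (v r - w r) \<le> L * norm (history_op u0 v r - history_op u0 w r)"
    using v[OF r(1)] w[OF r(1)] lip[of r] sub r(1) by auto
  also have "\<dots> = L * norm (integral {0..r} (\<lambda>s. v s - w s))"
    by (simp add: history_op_def integral_diff[OF int_r])
  also have "\<dots> \<le> L * (q r / \<kappa> * exp (\<kappa> * r))"
  proof (intro mult_left_mono norm_integral_le_exp integrable_diff int_r)
    show "norm (v s - w s) \<le> q r * exp (\<kappa> * s)" if "s \<in> {0..r}" for s
      unfolding diff using r that by (intro mult_right_mono r(2)) auto
  qed (use r(1) \<kappa> L in \<open>auto simp: q_def\<close>)
  also have "\<dots> = q r * exp (\<kappa> * r) / 2"
    using L by (simp add: \<kappa>_def)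
  finally have "q r \<le> 0"
    unfolding diff by (simp add: mult_le_0_iff)
  then have "q t \<le> 0"
    using r(2)[OF t] by linarith
  then show ?thesis
    by (simp add: q_def mult_le_0_iff)
qed

text \<open>
  Let \<open>s\<close> be the supremum of the times up to which \<open>w\<close> is integrable.  Before \<open>s\<close> the function \<open>w\<close>
  coincides with the continuous solution \<open>v\<close>, by uniqueness on shorter intervals.  After \<open>s\<close> the
  integral of the nonintegrable \<open>w\<close> is the default value \<open>0\<close>, so that \<open>w t = F t u0\<close>.  Both
  pieces are continuous up to the boundary, hence \<open>w\<close> is integrable on the whole interval.
\<close>
lemma solution_integrable:
  assumes v: "continuous_on {0..T} v" "\<And>t. t \<in> {0..T} \<Longrightarrow> v t = F t (history_op u0 v t)"
    and w: "\<And>t. t \<in> {0..T} \<Longrightarrow> w t = F t (history_op u0 w t)"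
  shows "w integrable_on {0..T}"
proof -
  define P where "P = {t \<in> {0..T}. w integrable_on {0..t}}"
  have "0 \<in> P" using T integrable_on_refl[of w 0] by (simp add: P_def)
  have bdd: "bdd_above P" by (rule bdd_aboveI[of _ T]) (simp add: P_def)
  define s where "s = Sup P"
  have "s \<le> T"
    unfolding s_def using \<open>0 \<in> P\<close> by (intro cSup_least) (auto simp: P_def)
  moreover have "0 \<le> s"
    unfolding s_def by (rule cSup_upper[OF \<open>0 \<in> P\<close> bdd])
  ultimately have s: "0 \<le> s" "s \<le> T" by simp_all
  have before: "w t = v t" if t: "0 \<le> t" "t < s" for t
  proof -
    obtain a where a: "a \<in> P" "t < a"
      using t(2) less_cSup_iff[OF _ bdd, of t] \<open>0 \<in> P\<close> unfolding s_def by blast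
    then have aT: "a \<le> T" and w_int: "w integrable_on {0..a}"
      by (auto simp: P_def)
    have "continuous_on {0..a} v"
      using v(1) aT by (auto intro: continuous_on_subset)
    then have v_int: "v integrable_on {0..a}"
      by (rule integrable_continuous_interval)
    show ?thesis
      by (rule integrable_solutions_eq[OF aT w_int v_int w v(2)]) (use aT a(2) t in simp_all)
  qed
  have after: "w t = F t u0" if "s < t" "t \<le> T" for t
  proof -
    have "t \<notin> P"
      using that(1) cSup_upper[OF _ bdd] unfolding s_def by force
    then have "integral {0..t} w = 0"
      using that s(1) by (intro not_integrable_integral) (auto simp: P_def)
    then show ?thesis
      using w[of t] that s(1) by (simp add: history_op_def)
  qed
  have "continuous_on {0..s} v" "continuous_on {s..T} (\<lambda>t. F t u0)"
    using s v(1) F_cont[of u0] by (auto intro: continuous_on_subset)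
  then have int: "v integrable_on {0..s}" "(\<lambda>t. F t u0) integrable_on {s..T}"
    by (simp_all add: integrable_continuous_interval)
  have "w integrable_on {0..s}"
    by (rule integrable_spike_finite[where S = "{s}", OF _ before int(1)]) auto
  moreover have "w integrable_on {s..T}"
    by (rule integrable_spike_finite[where S = "{s}", OF _ after int(2)]) auto
  ultimately show ?thesis
    by (rule Henstock_Kurzweil_Integration.integrable_combine[OF s])
qed

theorem ex_unique_solution:
  "\<exists>v. continuous_on {0..T} v \<and> (\<forall>t\<in>{0..T}. v t = F t (history_op u0 v t)) \<and>
     (\<forall>w. (\<forall>t\<in>{0..T}. w t = F t (history_op u0 w t)) \<longrightarrow> (\<forall>t\<in>{0..T}. w t = v t))"
proof -
  obtain v where v: "continuous_on {0..T} v" "\<And>t. t \<in> {0..T} \<Longrightarrow> v t = F t (history_op u0 v t)"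
    using ex_continuous_solution by blast
  have "w t = v t" if w: "\<And>t. t \<in> {0..T} \<Longrightarrow> w t = F t (history_op u0 w t)" and t: "t \<in> {0..T}" for w t
    by (rule integrable_solutions_eq[OF order_refl solution_integrable[OF v w]
          integrable_continuous_interval[OF v(1)] w v(2) t])
  then show ?thesis
    using v by blast
qed

end

section \<open>The history-dependent inequality\<close>

theorem theorem1:
  fixes A B :: "'v::banach \<Rightarrow> 'v \<Rightarrow>\<^sub>L real"
    and \<gamma> :: "'v \<Rightarrow>\<^sub>L 'x::banach"
    and J :: "'x \<Rightarrow> 'x \<Rightarrow> real"
    and f :: "real \<Rightarrow> 'v \<Rightarrow>\<^sub>L real"
    and u0 :: 'v
    and T m_A L_B c0 c1 c2 m_J1 m_J2 :: real
  assumes V_reflexive: "reflexive_space TYPE('v)"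
    and T_pos: "T > 0"
    and A_linear: "bounded_linear A"
    and A_symmetric: "\<And>u v. blinfun_apply (A u) v = blinfun_apply (A v) u"
    and A_coercive: "m_A > 0" "\<And>u. blinfun_apply (A u) u \<ge> m_A * (norm u)\<^sup>2"
    and B_lipschitz: "L_B > 0" "\<And>v w. norm (B v - B w) \<le> L_B * norm (v - w)"
    and J_lipschitz: "\<And>w. locally_lipschitz (J w)"
    and J_bound: "c0 \<ge> 0" "c1 \<ge> 0" "c2 \<ge> 0"
      "\<And>w v \<xi>. \<xi> \<in> clarke_subdiff (J w) v \<Longrightarrow> norm \<xi> \<le> c0 + c1 * norm w + c2 * norm v"
    and J_relaxed: "m_J1 \<ge> 0" "m_J2 \<ge> 0"
      "\<And>w1 w2 v1 v2. clarke_deriv (J w1) v1 (v2 - v1) + clarke_deriv (J w2) v2 (v1 - v2)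
         \<le> m_J1 * (norm (v1 - v2))\<^sup>2 + m_J2 * norm (w1 - w2) * norm (v1 - v2)"
    and f_continuous: "continuous_on {0..T} f"
    and smallness: "m_A - 2 * m_J1 * (norm \<gamma>)\<^sup>2 > 0"
  shows "\<exists>v. continuous_on {0..T} v \<and> hemivar_solution T A B J \<gamma> f u0 v \<and>
           (\<forall>v'. bochner_L2 T v' \<and> hemivar_solution T A B J \<gamma> f u0 v' \<longrightarrow> (\<forall>t\<in>{0..T}. v' t = v t))"
proof -
  define \<alpha> where "\<alpha> = m_A - m_J1 * (norm \<gamma>)\<^sup>2"
  have m_small: "m_J1 * (norm \<gamma>)\<^sup>2 < m_A"
  proof -
    have "0 \<le> m_J1 * (norm \<gamma>)\<^sup>2"
      using J_relaxed(1) by simp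
    then show ?thesis
      using smallness by linarith
  qed
  then have \<alpha>: "\<alpha> > 0" by (simp add: \<alpha>_def)
  \<comment> \<open>\<open>stat \<xi> w v\<close>: the inequality at one time, with load \<open>\<xi>\<close>, history \<open>w\<close> and unknown \<open>v\<close>.\<close>
  define stat where "stat = (\<lambda>\<xi> w v. \<forall>z. blinfun_apply (\<xi> - B w) z
      \<le> blinfun_apply (A v) z + clarke_deriv (J (\<gamma> w)) (\<gamma> v) (\<gamma> z))"
  have stat_ex: "\<exists>v. stat \<xi> w v" for \<xi> w
    unfolding stat_def
    using A_linear A_symmetric A_coercive(2) J_lipschitz J_relaxed(1) m_small
      J_relaxed(3)[of "\<gamma> w" _ _ "\<gamma> w"]
    by (intro stationary_hemivar_exists[where a = m_A and m = m_J1]) auto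
  have stat_stable: "\<alpha> * norm (v1 - v2)
      \<le> norm (\<xi>1 - \<xi>2) + (L_B + m_J2 * (norm \<gamma>)\<^sup>2) * norm (w1 - w2)"
    if "stat \<xi>1 w1 v1" "stat \<xi>2 w2 v2" for \<xi>1 \<xi>2 w1 w2 v1 v2
  proof -
    have "\<alpha> * norm (v1 - v2) \<le> norm ((\<xi>1 - B w1) - (\<xi>2 - B w2)) + m_J2 * norm (\<gamma> w1 - \<gamma> w2) * norm \<gamma>"
      unfolding \<alpha>_def
      using that J_relaxed A_linear A_coercive(2) unfolding stat_def
      by (intro stationary_hemivar_stable[where ?j1.0 = "J (\<gamma> w1)" and ?j2.0 = "J (\<gamma> w2)"]) auto
    moreover have "norm ((\<xi>1 - B w1) - (\<xi>2 - B w2)) \<le> norm (\<xi>1 - \<xi>2) + L_B * norm (w1 - w2)"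
      using norm_triangle_ineq4[of "\<xi>1 - \<xi>2" "B w1 - B w2"] B_lipschitz(2)[of w1 w2]
      by (simp add: algebra_simps)
    moreover have "m_J2 * norm (\<gamma> w1 - \<gamma> w2) * norm \<gamma> \<le> m_J2 * (norm \<gamma> * norm (w1 - w2)) * norm \<gamma>"
      using norm_blinfun[of \<gamma> "w1 - w2"] J_relaxed(2)
      by (intro mult_right_mono mult_left_mono) (auto simp: blinfun.diff_right)
    ultimately show ?thesis
      by (simp add: power2_eq_square algebra_simps)
  qed
  define S where "S = (\<lambda>\<xi> w. SOME v. stat \<xi> w v)"
  have S: "stat \<xi> w (S \<xi> w)" for \<xi> w
    unfolding S_def using stat_ex by (rule someI_ex)
  have stat_iff: "stat \<xi> w v \<longleftrightarrow> v = S \<xi> w" for \<xi> w v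
    using stat_stable[of \<xi> w v \<xi> w "S \<xi> w"] S \<alpha> by (auto simp: mult_le_0_iff)
  \<comment> \<open>At each time the inequality determines \<open>v t\<close> from the history, which turns it into an equation.\<close>
  have solution_iff: "hemivar_solution T A B J \<gamma> f u0 v
      \<longleftrightarrow> (\<forall>t\<in>{0..T}. v t = S (f t) (history_op u0 v t))" for v
    unfolding hemivar_solution_def stat_iff[symmetric] stat_def
    by (simp add: blinfun.bilinear_simps algebra_simps)
  interpret volterra_equation "\<lambda>t. S (f t)" "(L_B + m_J2 * (norm \<gamma>)\<^sup>2) / \<alpha>" T u0
  proof
    show "0 \<le> T"
      using T_pos by simp
    show "0 < (L_B + m_J2 * (norm \<gamma>)\<^sup>2) / \<alpha>"
      using \<alpha> B_lipschitz(1) J_relaxed(2) by (simp add: add_pos_nonneg)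
    show "norm (S (f t) a - S (f t) b) \<le> (L_B + m_J2 * (norm \<gamma>)\<^sup>2) / \<alpha> * norm (a - b)" for t a b
      using stat_stable[OF S S, of "f t" a "f t" b] \<alpha> by (simp add: field_simps)
    show "continuous_on {0..T} (\<lambda>t. S (f t) a)" for a
    proof -
      have "(1 / \<alpha>)-lipschitz_on UNIV (\<lambda>\<xi>. S \<xi> a)"
      proof (rule lipschitz_onI)
        show "dist (S \<xi>1 a) (S \<xi>2 a) \<le> 1 / \<alpha> * dist \<xi>1 \<xi>2" for \<xi>1 \<xi>2
          using stat_stable[OF S S, of \<xi>1 a \<xi>2 a] \<alpha> by (simp add: dist_norm field_simps)
      qed (use \<alpha> in simp)
      then show ?thesis
        by (intro continuous_on_compose2[OF lipschitz_on_continuous_on f_continuous]) auto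
    qed
  qed
  show ?thesis
    using ex_unique_solution unfolding solution_iff by blast
qed

end
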